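(* Let $(X,\varepsilon)$ be a random vector with $X$ taking values in a measurable space $(\mathcal X,\mathcal A)$ with marginal law $P_X$, $\varepsilon$ real-valued, $E(\varepsilon\mid X)=0$, and such that $\sigma^2(x)=E(\varepsilon^2\mid X=x)$ admits a bounded version. Let $e_1,e_2,\dots$ be an orthonormal basis of $L_2(\mathcal X,\mathcal A,P_X)$, let $\mathcal F\subset L_2(\mathcal X,\mathcal A,P_X)$ be a uniformly bounded collection of functions, and let $\Theta\subset\ell_2$ be the set of sequences of Fourier coefficients $\theta=(\theta_1,\theta_2,\dots)$, $\theta_i=\int fe_i\,dP_X$, of the functions $f\in\mathcal F$. For $\theta\in\Theta$ corresponding to $f\in\mathcal F$ let, under $P_\theta$, $(X_1,Y_1),\dots,(X_n,Y_n)$ ($n\ge2$) be an i.i.d. sample from the distribution of $(X,Y)$ with $Y=f(X)+\varepsilon$, and let $\hat\theta^{(n)}$ be an initial estimator that is independent of this sample. Define $$R_{k,n}(\hat\theta^{(n)})=\frac1{n(n-1)}\sum_{\substack{r,s=1\\ r\ne s}}^n\ \sum_{i=1}^k(Y_re_i(X_r)-\hat\theta_i^{(n)})(Y_se_i(X_s)-\hat\theta_i^{(n)}),$$ $$\hat\tau_{k,n,\theta}^2=\frac{2k(\|f\|_\infty^2+\|\sigma^2\|_\infty)^2}{n(n-1)}+\frac{4\|f\|_\infty^2+4\|\sigma\|_\infty^2}{n}\sum_{i=1}^k(\theta_i-\hat\theta_i^{(n)})^2 .$$ Then for any $k,n$, $$\sup_{\theta\in\Theta}E_\theta\left(\left(\frac{R_{k,n}(\hat\theta^{(n)})-\sum_{i=1}^k(\theta_i-\hat\theta_i^{(n)})^2}{\hat\tau_{k,n,\theta}}\right)^2\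 \Big|\ \hat\theta^{(n)}\right)\le1 .$$
   Context: $\|\cdot\|_\infty$ is the supremum norm, and $\sigma=\sqrt{\sigma^2(\cdot)}$. The variables $X$ and $\varepsilon$ need not be independent and $\varepsilon$ need not be normal. The initial estimator $\hat\theta^{(n)}$ is a random element of $\ell_2$ (square-summable real sequences) based on data independent of the sample $(X_1,Y_1),\dots,(X_n,Y_n)$ (obtained by sample splitting); the conditional expectation given $\hat\theta^{(n)}$ is computed by treating $\hat\theta^{(n)}$ as fixed at its value and using only the law of the sample under $\theta$. In the degenerate case $\hat\tau_{k,n,\theta}=0$ the quotient $0/0$ is read as $0$. *)

theory Defs
  imports "HOL-Probability.Probability"
begin

section \<open>Function and sequence spaces\<close>

text \<open>Elements of \<open>L\<^sub>2\<close> are represented by square-integrable functions rather than by classes,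
  since the bounds below involve their pointwise suprema.\<close>

definition L2_space :: "'x measure \<Rightarrow> ('x \<Rightarrow> real) set" where
  "L2_space Q = {f \<in> borel_measurable Q. integrable Q (\<lambda>x. (f x)\<^sup>2)}"

text \<open>Orthonormal, with dense linear span. Indices start at 0: \<open>e i\<close> is \<open>e\<^sub>i\<^sub>+\<^sub>1\<close> of the usual
  enumeration \<open>e\<^sub>1, e\<^sub>2, \<dots>\<close>, and likewise for all coordinate sequences.\<close>

definition L2_orthonormal_basis :: "'x measure \<Rightarrow> (nat \<Rightarrow> 'x \<Rightarrow> real) \<Rightarrow> bool" where
  "L2_orthonormal_basis Q e \<longleftrightarrow>
     (\<forall>i. e i \<in> L2_space Q) \<and>
     (\<forall>i j. (\<integral>x. e i x * e j x \<partial>Q) = (if i = j then 1 else 0)) \<and>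
     (\<forall>f \<in> L2_space Q. \<forall>\<delta>>0. \<exists>N c. (\<integral>x. (f x - (\<Sum>i<N. c i * e i x))\<^sup>2 \<partial>Q) < \<delta>)"

definition fourier_coeffs :: "'x measure \<Rightarrow> (nat \<Rightarrow> 'x \<Rightarrow> real) \<Rightarrow> ('x \<Rightarrow> real) \<Rightarrow> nat \<Rightarrow> real" where
  "fourier_coeffs Q e f i = (\<integral>x. f x * e i x \<partial>Q)"

text \<open>Used only for functions that are bounded on \<open>space A\<close>.\<close>

definition sup_norm :: "'x measure \<Rightarrow> ('x \<Rightarrow> real) \<Rightarrow> real" where
  "sup_norm A f = (SUP x \<in> space A. \<bar>f x\<bar>)"

text \<open>The space \<open>\<ell>\<^sub>2\<close> with the \<open>\<sigma>\<close>-algebra generated by the coordinates, which by separability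
  is the Borel \<open>\<sigma>\<close>-algebra of the \<open>\<ell>\<^sub>2\<close>-norm.\<close>

definition ell2 :: "(nat \<Rightarrow> real) set" where
  "ell2 = {t. summable (\<lambda>i. (t i)\<^sup>2)}"

definition ell2_measurable_space :: "(nat \<Rightarrow> real) measure" where
  "ell2_measurable_space = restrict_space (Pi\<^sub>M UNIV (\<lambda>_. borel)) ell2"


section \<open>Conditional expectations\<close>

text \<open>\<open>g\<close> is a version of \<open>x \<mapsto> E(Z | X = x)\<close>. Integrability is included because
  \<^const>\<open>real_cond_exp\<close> is meaningful only for integrable \<open>Z\<close>.\<close>

definition cond_exp_version ::
  "'w measure \<Rightarrow> 'x measure \<Rightarrow> ('w \<Rightarrow> 'x) \<Rightarrow> ('w \<Rightarrow> real) \<Rightarrow> ('x \<Rightarrow> real) \<Rightarrow> bool" where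
  "cond_exp_version M A X Z g \<longleftrightarrow>
     g \<in> borel_measurable A \<and> integrable M Z \<and>
     (AE \<omega> in M. real_cond_exp M (vimage_algebra (space M) X A) Z \<omega> = g (X \<omega>))"

text \<open>The library's \<open>indep_var\<close> forces both variables to have the same value type.\<close>

definition indep_rvs ::
  "'v measure \<Rightarrow> 't measure \<Rightarrow> ('v \<Rightarrow> 't) \<Rightarrow> 'z measure \<Rightarrow> ('v \<Rightarrow> 'z) \<Rightarrow> bool" where
  "indep_rvs P N T K Z \<longleftrightarrow>
     T \<in> P \<rightarrow>\<^sub>M N \<and> Z \<in> P \<rightarrow>\<^sub>M K \<and>
     prob_space.indep_set P (sets (vimage_algebra (space P) T N)) (sets (vimage_algebra (space P) Z K))"

text \<open>The conditional expectation of \<open>g T Z\<close> given a variable \<open>T\<close> independent of \<open>Z\<close>, computed by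
  freezing \<open>T\<close> at its value and integrating over \<open>Z\<close> alone. Choosing this version everywhere,
  rather than up to null sets, gives a meaning to suprema over uncountable families of \<open>P\<close>.
  The lemma below confirms that it is a version of \<^const>\<open>nn_cond_exp\<close>.\<close>

definition cond_exp_given ::
  "'v measure \<Rightarrow> ('v \<Rightarrow> 't) \<Rightarrow> ('v \<Rightarrow> 'z) \<Rightarrow> ('t \<Rightarrow> 'z \<Rightarrow> ennreal) \<Rightarrow> 'v \<Rightarrow> ennreal" where
  "cond_exp_given P T Z g \<omega> = (\<integral>\<^sup>+\<omega>'. g (T \<omega>) (Z \<omega>') \<partial>P)"

lemma cond_exp_given_is_nn_cond_exp:
  assumes "prob_space P" and ind: "indep_rvs P N T K Z"
    and g[measurable]: "case_prod g \<in> borel_measurable (N \<Otimes>\<^sub>M K)"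
  shows "AE \<omega> in P. cond_exp_given P T Z g \<omega> =
           nn_cond_exp P (vimage_algebra (space P) T N) (\<lambda>\<omega>. g (T \<omega>) (Z \<omega>)) \<omega>"
proof -
  interpret prob_space P by fact
  have T[measurable]: "T \<in> P \<rightarrow>\<^sub>M N" and Z[measurable]: "Z \<in> P \<rightarrow>\<^sub>M K"
    and I: "indep_set (sets (vimage_algebra (space P) T N)) (sets (vimage_algebra (space P) Z K))"
    using ind by (auto simp: indep_rvs_def)
  let ?F = "vimage_algebra (space P) T N"
  have sub: "subalgebra P ?F"
    using sets_image_in_sets[OF refl T] by (simp add: subalgebra_def)
  interpret finite_measure_subalgebra P ?F
    by standard (rule sub)
  interpret DT: prob_space "distr P N T" by (rule prob_space_distr) simp
  interpret DZ: prob_space "distr P K Z" by (rule prob_space_distr) simp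
  interpret TZ: pair_sigma_finite "distr P N T" "distr P K Z" ..
  have joint: "distr P N T \<Otimes>\<^sub>M distr P K Z = distr P (N \<Otimes>\<^sub>M K) (\<lambda>\<omega>. (T \<omega>, Z \<omega>))"
  proof (rule pair_measure_eqI)
    fix B C assume B: "B \<in> sets (distr P N T)" and C: "C \<in> sets (distr P K Z)"
    have "prob ((T -` B \<inter> space P) \<inter> (Z -` C \<inter> space P)) = prob (T -` B \<inter> space P) * prob (Z -` C \<inter> space P)"
      using B C by (intro indep_setD[OF I] in_vimage_algebra) auto
    moreover have "(\<lambda>\<omega>. (T \<omega>, Z \<omega>)) -` (B \<times> C) \<inter> space P = (T -` B \<inter> space P) \<inter> (Z -` C \<inter> space P)"
      by auto
    ultimately show "emeasure (distr P N T) B * emeasure (distr P K Z) C =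
        emeasure (distr P (N \<Otimes>\<^sub>M K) (\<lambda>\<omega>. (T \<omega>, Z \<omega>))) (B \<times> C)"
      using B C by (simp add: emeasure_distr emeasure_eq_measure ennreal_mult'' measure_nonneg)
  qed (auto intro: DT.sigma_finite_measure_axioms DZ.sigma_finite_measure_axioms)
  let ?G = "\<lambda>t. \<integral>\<^sup>+z. g t z \<partial>distr P K Z"
  have G[measurable]: "?G \<in> borel_measurable N"
    by (rule DZ.borel_measurable_nn_integral)
      (subst measurable_cong_sets[OF sets_pair_measure_cong[OF refl sets_distr] refl], rule g)
  have eq: "cond_exp_given P T Z g \<omega> = ?G (T \<omega>)" if "\<omega> \<in> space P" for \<omega>
  proof -
    have "T \<omega> \<in> space N" using that T by (rule measurable_space[rotated])
    then have "(\<lambda>z. g (T \<omega>) z) \<in> borel_measurable K"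
      using measurable_compose[OF measurable_Pair1' g] by simp
    then show ?thesis by (simp add: cond_exp_given_def nn_integral_distr)
  qed
  have TF: "T \<in> ?F \<rightarrow>\<^sub>M N"
    using T by (intro measurable_vimage_algebra1) (auto simp: measurable_def)
  show ?thesis
  proof (rule nn_cond_exp_charact)
    show "(\<lambda>\<omega>. g (T \<omega>) (Z \<omega>)) \<in> borel_measurable P"
      using measurable_compose[OF measurable_Pair[OF T Z] g] by simp
    have "(\<lambda>\<omega>. ?G (T \<omega>)) \<in> borel_measurable ?F"
      by (rule measurable_compose[OF TF G])
    then show "cond_exp_given P T Z g \<in> borel_measurable ?F"
      by (subst measurable_cong[where g="\<lambda>\<omega>. ?G (T \<omega>)"]) (auto simp: eq)
  next
    fix E assume "E \<in> sets ?F"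
    then obtain B where B[measurable]: "B \<in> sets N" and E: "E = T -` B \<inter> space P"
      using T by (subst (asm) sets_vimage_algebra2) (auto simp: measurable_def)
    have h: "(\<lambda>(t, z). g t z * indicator B t) \<in> borel_measurable (N \<Otimes>\<^sub>M K)"
      using g by measurable
    have "(\<integral>\<^sup>+\<omega>\<in>E. g (T \<omega>) (Z \<omega>) \<partial>P) = (\<integral>\<^sup>+\<omega>. (\<lambda>(t, z). g t z * indicator B t) (T \<omega>, Z \<omega>) \<partial>P)"
      by (intro nn_integral_cong) (auto simp: E indicator_def)
    also have "\<dots> = (\<integral>\<^sup>+p. (\<lambda>(t, z). g t z * indicator B t) p \<partial>distr P (N \<Otimes>\<^sub>M K) (\<lambda>\<omega>. (T \<omega>, Z \<omega>)))"
      using h by (subst nn_integral_distr) auto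
    also have "\<dots> = (\<integral>\<^sup>+t. \<integral>\<^sup>+z. g t z * indicator B t \<partial>distr P K Z \<partial>distr P N T)"
      unfolding joint[symmetric]
      by (subst DZ.nn_integral_fst[symmetric],
          subst measurable_cong_sets[OF sets_pair_measure_cong[OF sets_distr sets_distr] refl])
        (use h in auto)
    also have "\<dots> = (\<integral>\<^sup>+t. ?G t * indicator B t \<partial>distr P N T)"
      by (intro nn_integral_cong) (auto simp: indicator_def)
    also have "\<dots> = (\<integral>\<^sup>+\<omega>. ?G (T \<omega>) * indicator B (T \<omega>) \<partial>P)"
      by (subst nn_integral_distr) auto
    also have "\<dots> = (\<integral>\<^sup>+\<omega>\<in>E. cond_exp_given P T Z g \<omega> \<partial>P)"
      by (intro nn_integral_cong) (auto simp: E indicator_def eq)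
    finally show "(\<integral>\<^sup>+\<omega>\<in>E. g (T \<omega>) (Z \<omega>) \<partial>P) = (\<integral>\<^sup>+\<omega>\<in>E. cond_exp_given P T Z g \<omega> \<partial>P)" .
  qed
qed


section \<open>The regression sample and the estimator of the squared distance\<close>

definition iid_sample ::
  "'v measure \<Rightarrow> 'z measure \<Rightarrow> nat \<Rightarrow> (nat \<Rightarrow> 'v \<Rightarrow> 'z) \<Rightarrow> bool" where
  "iid_sample P L n Z \<longleftrightarrow>
     prob_space.indep_vars P (\<lambda>_. L) Z {..<n} \<and> (\<forall>r<n. distr P L (Z r) = L)"

definition sample_of :: "nat \<Rightarrow> (nat \<Rightarrow> 'v \<Rightarrow> 'z) \<Rightarrow> 'v \<Rightarrow> nat \<Rightarrow> 'z" where
  "sample_of n Z \<omega> = (\<lambda>r\<in>{..<n}. Z r \<omega>)"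

text \<open>Here \<open>z r = (X\<^sub>r, Y\<^sub>r)\<close> are the observations and \<open>t\<close> is the value of the initial estimator.\<close>

definition R_stat ::
  "(nat \<Rightarrow> 'x \<Rightarrow> real) \<Rightarrow> nat \<Rightarrow> nat \<Rightarrow> (nat \<Rightarrow> real) \<Rightarrow> (nat \<Rightarrow> 'x \<times> real) \<Rightarrow> real" where
  "R_stat e k n t z =
     1 / (real n * (real n - 1)) *
     (\<Sum>r<n. \<Sum>s \<in> {..<n} - {r}. \<Sum>i<k.
        (snd (z r) * e i (fst (z r)) - t i) * (snd (z s) * e i (fst (z s)) - t i))"

definition sq_dist :: "nat \<Rightarrow> (nat \<Rightarrow> real) \<Rightarrow> (nat \<Rightarrow> real) \<Rightarrow> real" where
  "sq_dist k \<theta> t = (\<Sum>i<k. (\<theta> i - t i)\<^sup>2)"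

definition tau_hat ::
  "'x measure \<Rightarrow> ('x \<Rightarrow> real) \<Rightarrow> ('x \<Rightarrow> real) \<Rightarrow> nat \<Rightarrow> nat \<Rightarrow> (nat \<Rightarrow> real) \<Rightarrow> (nat \<Rightarrow> real) \<Rightarrow> real" where
  "tau_hat A f \<sigma>2 k n \<theta> t = sqrt (
     2 * real k * ((sup_norm A f)\<^sup>2 + sup_norm A \<sigma>2)\<^sup>2 / (real n * (real n - 1)) +
     (4 * (sup_norm A f)\<^sup>2 + 4 * (sup_norm A (\<lambda>x. sqrt (\<sigma>2 x)))\<^sup>2) / real n * sq_dist k \<theta> t)"

text \<open>The division is that of \<^typ>\<open>ennreal\<close>, where \<open>0 / 0 = 0\<close> but \<open>c / 0 = \<infinity>\<close> for \<open>c > 0\<close>;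
  division of reals would also set the latter to 0.\<close>

definition normalized_sq_error ::
  "'x measure \<Rightarrow> (nat \<Rightarrow> 'x \<Rightarrow> real) \<Rightarrow> ('x \<Rightarrow> real) \<Rightarrow> ('x \<Rightarrow> real) \<Rightarrow> nat \<Rightarrow> nat \<Rightarrow> (nat \<Rightarrow> real) \<Rightarrow>
   (nat \<Rightarrow> real) \<Rightarrow> (nat \<Rightarrow> 'x \<times> real) \<Rightarrow> ennreal" where
  "normalized_sq_error A e f \<sigma>2 k n \<theta> t z =
     (ennreal \<bar>R_stat e k n t z - sq_dist k \<theta> t\<bar> / ennreal (tau_hat A f \<sigma>2 k n \<theta> t))\<^sup>2"

end

theory Submission
  imports Defs
begin

text \<open>Write \<open>t\<close> for the fixed value of the initial estimator, \<open>\<delta> = \<theta> - t\<close>, and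
  \<open>\<xi>\<^sub>r\<^sub>i = Y\<^sub>r e\<^sub>i(X\<^sub>r) - \<theta>\<^sub>i\<close>. Since \<open>E(\<epsilon> | X) = 0\<close>, the vectors \<open>\<xi>\<^sub>r\<close> are i.i.d. and centred, and expanding
  \<open>Y\<^sub>r e\<^sub>i(X\<^sub>r) - t\<^sub>i = \<xi>\<^sub>r\<^sub>i + \<delta>\<^sub>i\<close> gives the Hoeffding decomposition of the error,
  \<open>(1/(n(n-1))) \<Sum>\<^sub>r\<^sub>\<noteq>\<^sub>s \<langle>\<xi>\<^sub>r, \<xi>\<^sub>s\<rangle> + (2/n) \<Sum>\<^sub>r \<langle>\<delta>, \<xi>\<^sub>r\<rangle>\<close>.
  All its terms are centred, and those of distinct index sets are uncorrelated, so with
  \<open>C\<close> the covariance matrix of \<open>\<xi>\<^sub>1\<close> the mean square error is exactly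
  \<open>2/(n(n-1)) tr C\<^sup>2 + (4/n) \<delta>\<^sup>T C \<delta>\<close> (lemma \<open>U_stat_second_moment\<close>).\<close>

text \<open>Both terms are controlled by the single operator bound \<open>C \<le> b I\<close> with \<open>b = \<parallel>f\<parallel>\<^sup>2 + \<parallel>\<sigma>\<^sup>2\<parallel>\<close>. It holds
  because, for \<open>g = \<Sum>\<^sub>i v\<^sub>i e\<^sub>i\<close>, the variance \<open>v\<^sup>T C v\<close> of \<open>Y g(X)\<close> is at most
  \<open>E Y\<^sup>2 g(X)\<^sup>2 = E (f\<^sup>2 + \<sigma>\<^sup>2)(X) g(X)\<^sup>2 \<le> b E g(X)\<^sup>2 = b |v|\<^sup>2\<close>, where conditioning on \<open>X\<close> removes the
  cross term and the last step is orthonormality (lemma \<open>regression_moments\<close>). As \<open>C\<close> is a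
  \<open>k \<times> k\<close> matrix with \<open>0 \<le> C \<le> b I\<close>, also \<open>tr C\<^sup>2 \<le> k b\<^sup>2\<close> (lemma \<open>sum_sq_le_of_quadratic_form_le\<close>).
  The mean square error is therefore at most the square of the normalisation. If the latter
  vanishes, the error is null almost surely and the quotient is \<open>0 / 0 = 0\<close>.\<close>

section \<open>Square-integrable functions\<close>

lemma L2_spaceD:
  assumes "f \<in> L2_space Q"
  shows "f \<in> borel_measurable Q" "integrable Q (\<lambda>x. (f x)\<^sup>2)"
  using assms by (auto simp: L2_space_def)

lemma integrable_mult_L2_space:
  assumes "f \<in> L2_space Q" "g \<in> L2_space Q"
  shows "integrable Q (\<lambda>x. f x * g x)"
proof (rule Bochner_Integration.integrable_bound)
  note [measurable] = L2_spaceD(1)[OF assms(1)] L2_spaceD(1)[OF assms(2)]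
  show "integrable Q (\<lambda>x. (f x)\<^sup>2 + (g x)\<^sup>2)"
    using assms by (intro Bochner_Integration.integrable_add L2_spaceD)
  show "(\<lambda>x. f x * g x) \<in> borel_measurable Q"
    by measurable
  have "\<bar>a * b\<bar> \<le> a\<^sup>2 + b\<^sup>2" for a b :: real
    using sum_squares_bound[of "\<bar>a\<bar>" "\<bar>b\<bar>"] mult_nonneg_nonneg[of "\<bar>a\<bar>" "\<bar>b\<bar>"]
    unfolding abs_mult power2_abs by linarith
  then show "AE x in Q. norm (f x * g x) \<le> norm ((f x)\<^sup>2 + (g x)\<^sup>2)"
    by simp
qed

lemma L2_space_add:
  assumes "f \<in> L2_space Q" "g \<in> L2_space Q"
  shows "(\<lambda>x. f x + g x) \<in> L2_space Q"
  using assms integrable_mult_L2_space[OF assms]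
  by (auto simp: L2_space_def power2_sum mult.assoc)

lemma L2_space_cmult:
  assumes "f \<in> L2_space Q"
  shows "(\<lambda>x. c * f x) \<in> L2_space Q"
  using assms by (auto simp: L2_space_def power_mult_distrib)

lemma L2_space_sum:
  assumes "\<And>i. i \<in> I \<Longrightarrow> f i \<in> L2_space Q"
  shows "(\<lambda>x. \<Sum>i\<in>I. f i x) \<in> L2_space Q"
  using assms
proof (induction I rule: infinite_finite_induct)
  case (insert i I)
  then show ?case using L2_space_add[of "f i" Q "\<lambda>x. \<Sum>i\<in>I. f i x"] by simp
qed (simp_all add: L2_space_def)

lemma L2_space_const: "finite_measure Q \<Longrightarrow> (\<lambda>x. c) \<in> L2_space Q"
  by (simp add: L2_space_def finite_measure.integrable_const)

lemma L2_space_imp_integrable: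
  "finite_measure Q \<Longrightarrow> f \<in> L2_space Q \<Longrightarrow> integrable Q f"
  using integrable_mult_L2_space[OF _ L2_space_const[of Q 1]] by auto

text \<open>For the Gram matrix \<open>C\<close> of the functions \<open>h\<^sub>i\<close>, the hypothesis is \<open>C \<le> B I\<close> and the conclusion bounds
  \<open>tr C\<^sup>2\<close>. Each row of \<open>C\<close> has norm at most \<open>B\<close>: if \<open>v\<close> is row \<open>i\<close> and \<open>w = \<Sum>\<^sub>j v\<^sub>j h\<^sub>j\<close>, then \<open>h\<^sub>i\<close> and \<open>w\<close> have
  inner product \<open>|v|\<^sup>2\<close>, while their squared norms are at most \<open>B\<close> and \<open>B |v|\<^sup>2\<close>, so Cauchy--Schwarz gives
  \<open>|v|\<^sup>4 \<le> B\<^sup>2 |v|\<^sup>2\<close>.\<close>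

lemma sum_sq_le_of_quadratic_form_le:
  fixes h :: "nat \<Rightarrow> 'z \<Rightarrow> real"
  assumes h: "\<And>i. h i \<in> L2_space L"
    and B: "\<And>v. (\<integral>z. (\<Sum>i<k. v i * h i z)\<^sup>2 \<partial>L) \<le> B * (\<Sum>i<k. (v i)\<^sup>2)" and "0 \<le> B"
  shows "(\<Sum>i<k. \<Sum>j<k. (\<integral>z. h i z * h j z \<partial>L)\<^sup>2) \<le> real k * B\<^sup>2"
proof -
  have "(\<Sum>j<k. (\<integral>z. h i z * h j z \<partial>L)\<^sup>2) \<le> B\<^sup>2" if "i < k" for i
  proof -
    define v where "v j = (\<integral>z. h i z * h j z \<partial>L)" for j
    define w where "w z = (\<Sum>j<k. v j * h j z)" for z
    define s where "s = (\<Sum>j<k. (v j)\<^sup>2)"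
    have w: "w \<in> L2_space L"
      unfolding w_def by (intro L2_space_sum L2_space_cmult h)
    have hw: "(\<integral>z. h i z * w z \<partial>L) = s"
      unfolding w_def s_def
      by (subst sum_distrib_left, subst Bochner_Integration.integral_sum)
        (auto simp: v_def power2_eq_square mult.left_commute[of "h i _"] intro!: integrable_mult_L2_space h)
    have hi: "(\<integral>z. (h i z)\<^sup>2 \<partial>L) \<le> B"
      using B[of "\<lambda>j. if j = i then 1 else 0"] that
      by (simp add: if_distrib if_distribR sum.If_cases cong: if_cong)
    have ww: "(\<integral>z. (w z)\<^sup>2 \<partial>L) \<le> B * s"
      using B[of v] by (simp add: w_def s_def)
    \<comment> \<open>Cauchy--Schwarz in the form of a discriminant: the norm of \<open>a h\<^sub>i - w\<close> is nonnegative for all \<open>a\<close>.\<close>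
    have *: "2 * a * s \<le> a\<^sup>2 * B + B * s" for a
    proof -
      have "0 \<le> (\<integral>z. (a * h i z - w z)\<^sup>2 \<partial>L)" by simp
      also have "\<dots> = (\<integral>z. a\<^sup>2 * (h i z)\<^sup>2 + (w z)\<^sup>2 - 2 * a * (h i z * w z) \<partial>L)"
        by (intro Bochner_Integration.integral_cong) (auto simp: power2_eq_square algebra_simps)
      also have "\<dots> = a\<^sup>2 * (\<integral>z. (h i z)\<^sup>2 \<partial>L) + (\<integral>z. (w z)\<^sup>2 \<partial>L) - 2 * a * s"
        using L2_spaceD(2)[OF h, of i] L2_spaceD(2)[OF w] integrable_mult_L2_space[OF h w, of i]
        by (simp add: hw)
      also have "\<dots> \<le> a\<^sup>2 * B + B * s - 2 * a * s"
        using mult_left_mono[OF hi, of "a\<^sup>2"] ww by simp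
      finally show ?thesis by simp
    qed
    have "s \<le> B\<^sup>2"
    proof (cases "B = 0")
      case True then show ?thesis using *[of 1] by simp
    next
      case False
      with \<open>0 \<le> B\<close> have "0 < B" by simp
      moreover have "B * s \<le> B * B\<^sup>2"
        using *[of B] by (simp add: power2_eq_square algebra_simps)
      ultimately show ?thesis by simp
    qed
    then show ?thesis by (simp add: s_def v_def)
  qed
  then have "(\<Sum>i<k. \<Sum>j<k. (\<integral>z. h i z * h j z \<partial>L)\<^sup>2) \<le> (\<Sum>i<k. B\<^sup>2)"
    by (intro sum_mono) auto
  then show ?thesis by simp
qed

section \<open>Independent samples\<close>

text \<open>A new observation is independent of all previous ones jointly. This form of independence fits
  inductions over the sample size, which replace the enumeration of coinciding indices among the
  quadruples in the square of a double sum.\<close>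

lemma integral_past_mult_future:
  fixes v :: "(nat \<Rightarrow> 'z) \<Rightarrow> real" and g :: "'z \<Rightarrow> real"
  assumes P: "prob_space P" and iid: "iid_sample P L (Suc m) Z"
    and v: "v \<in> borel_measurable (PiM {..<m} (\<lambda>_. L))" "integrable P (\<lambda>\<omega>. v (sample_of m Z \<omega>))"
    and g: "integrable L g"
  shows "integrable P (\<lambda>\<omega>. v (sample_of m Z \<omega>) * g (Z m \<omega>))"
    and "(\<integral>\<omega>. v (sample_of m Z \<omega>) * g (Z m \<omega>) \<partial>P) = (\<integral>\<omega>. v (sample_of m Z \<omega>) \<partial>P) * (\<integral>z. g z \<partial>L)"
proof -
  interpret prob_space P by fact
  have ind: "indep_vars (\<lambda>_. L) Z {..<Suc m}" and dist: "distr P L (Z m) = L"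
    using iid by (auto simp: iid_sample_def)
  have Zm[measurable]: "Z m \<in> P \<rightarrow>\<^sub>M L"
    using ind by (auto simp: indep_vars_def2)
  have gm[measurable]: "g \<in> borel_measurable L" using g by auto
  have "indep_var (PiM {..<m} (\<lambda>_. L)) (\<lambda>\<omega>. restrict (\<lambda>i. Z i \<omega>) {..<m})
      (PiM {m} (\<lambda>_. L)) (\<lambda>\<omega>. restrict (\<lambda>i. Z i \<omega>) {m})"
    by (rule indep_var_restrict[OF ind]) auto
  then have "indep_var borel (v \<circ> (\<lambda>\<omega>. restrict (\<lambda>i. Z i \<omega>) {..<m}))
      borel ((\<lambda>z. g (z m)) \<circ> (\<lambda>\<omega>. restrict (\<lambda>i. Z i \<omega>) {m}))"
    by (rule indep_var_compose) (use v in measurable)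
  then have *: "indep_var borel (\<lambda>\<omega>. v (sample_of m Z \<omega>)) borel (\<lambda>\<omega>. g (Z m \<omega>))"
    by (simp add: comp_def sample_of_def)
  have gi: "integrable P (\<lambda>\<omega>. g (Z m \<omega>))"
    using g integrable_distr_eq[of "Z m" P L g] by (simp add: dist)
  have "(\<integral>\<omega>. g (Z m \<omega>) \<partial>P) = (\<integral>z. g z \<partial>L)"
    using integral_distr[OF Zm gm] by (simp add: dist)
  then show "(\<integral>\<omega>. v (sample_of m Z \<omega>) * g (Z m \<omega>) \<partial>P) = (\<integral>\<omega>. v (sample_of m Z \<omega>) \<partial>P) * (\<integral>z. g z \<partial>L)"
    using indep_var_lebesgue_integral[OF * v(2) gi] by simp
  show "integrable P (\<lambda>\<omega>. v (sample_of m Z \<omega>) * g (Z m \<omega>))"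
    using indep_var_integrable[OF * v(2) gi] .
qed

lemma iid_sample_mono:
  assumes "prob_space P" "iid_sample P L n Z" "m \<le> n"
  shows "iid_sample P L m Z"
  using assms prob_space.indep_vars_subset[of P "\<lambda>_. L" Z "{..<n}" "{..<m}"]
  by (auto simp: iid_sample_def)

lemma sample_of_nth: "r < n \<Longrightarrow> sample_of n Z \<omega> r = Z r \<omega>"
  by (simp add: sample_of_def)

lemma L2_space_observation:
  assumes P: "prob_space P" and iid: "iid_sample P L n Z" and "r < n" and h: "h \<in> L2_space L"
  shows "(\<lambda>\<omega>. h (Z r \<omega>)) \<in> L2_space P"
proof -
  interpret prob_space P by fact
  have d: "distr P L (Z r) = L" and Zr[measurable]: "Z r \<in> P \<rightarrow>\<^sub>M L"
    using iid \<open>r < n\<close> by (auto simp: iid_sample_def indep_vars_def2)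
  note [measurable] = L2_spaceD(1)[OF h]
  show ?thesis
    using integrable_distr_eq[OF Zr, of "\<lambda>z. (h z)\<^sup>2"] L2_spaceD(2)[OF h]
    by (auto simp: L2_space_def d)
qed

lemma iid_sample_prob_space:
  assumes P: "prob_space P" and iid: "iid_sample P L (Suc n) Z"
  shows "prob_space L"
proof -
  interpret prob_space P by fact
  have d: "distr P L (Z 0) = L" and "Z 0 \<in> P \<rightarrow>\<^sub>M L"
    using iid by (auto simp: iid_sample_def indep_vars_def2)
  then show ?thesis using prob_space_distr[of "Z 0" L] by simp
qed

section \<open>The second moment of a U-statistic of order two\<close>

text \<open>Partial sums of centred vectors enter the recursion of \<open>U_stat\<close> as coefficients of the new
  observation; their covariances grow linearly because increments are uncorrelated with the past.\<close>

lemma centred_sum_moments: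
  fixes h :: "nat \<Rightarrow> 'z \<Rightarrow> real"
  assumes P: "prob_space P" and iid: "iid_sample P L m Z"
    and h: "\<And>i. h i \<in> L2_space L" and mean0: "\<And>i. (\<integral>z. h i z \<partial>L) = 0"
  shows "(\<integral>\<omega>. (\<Sum>r<m. h i (Z r \<omega>)) \<partial>P) = 0"
    and "(\<integral>\<omega>. (\<Sum>r<m. h i (Z r \<omega>)) * (\<Sum>r<m. h j (Z r \<omega>)) \<partial>P) = real m * (\<integral>z. h i z * h j z \<partial>L)"
proof -
  interpret prob_space P by fact
  have fm: "finite_measure P" by unfold_locales
  have one: "(\<integral>\<omega>. g (Z r \<omega>) \<partial>P) = (\<integral>z. g z \<partial>L)" if "r < m" "g \<in> borel_measurable L" for r and g :: "'z \<Rightarrow> real"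
    using integral_distr[of "Z r" P L g] iid that by (auto simp: iid_sample_def indep_vars_def2)
  have hL2: "(\<lambda>\<omega>. h i (Z r \<omega>)) \<in> L2_space P" if "r < m" for i r
    using that by (rule L2_space_observation[OF P iid _ h])
  have "(\<integral>\<omega>. (\<Sum>r<m. h i (Z r \<omega>)) \<partial>P) = (\<Sum>r<m. \<integral>\<omega>. h i (Z r \<omega>) \<partial>P)" for i
    by (intro Bochner_Integration.integral_sum L2_space_imp_integrable[OF fm] hL2) auto
  then show mean: "(\<integral>\<omega>. (\<Sum>r<m. h i (Z r \<omega>)) \<partial>P) = 0" for i
    using one L2_spaceD(1)[OF h] by (simp add: mean0)
  show "(\<integral>\<omega>. (\<Sum>r<m. h i (Z r \<omega>)) * (\<Sum>r<m. h j (Z r \<omega>)) \<partial>P) = real m * (\<integral>z. h i z * h j z \<partial>L)"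
    using iid
  proof (induction m)
    case (Suc m)
    have iid: "iid_sample P L m Z"
      using iid_sample_mono[OF P Suc.prems] by simp
    have hL2: "(\<lambda>\<omega>. h i (Z r \<omega>)) \<in> L2_space P" if "r \<le> m" for i r
      using that by (intro L2_space_observation[OF P Suc.prems _ h]) simp
    define S where "S i \<omega> = (\<Sum>r<m. h i (Z r \<omega>))" for i \<omega>
    define s where "s i z = (\<Sum>r<m. h i (z r))" for i and z :: "nat \<Rightarrow> 'z"
    have Ss: "S i \<omega> = s i (sample_of m Z \<omega>)" for i \<omega>
      by (simp add: S_def s_def sample_of_nth)
    note [measurable] = L2_spaceD(1)[OF h]
    have sm: "s i \<in> borel_measurable (PiM {..<m} (\<lambda>_. L))" for i
      unfolding s_def by measurable
    have SL2: "S i \<in> L2_space P" for i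
      unfolding S_def by (intro L2_space_sum hL2) simp
    have cross: "(\<integral>\<omega>. S i \<omega> * h j (Z m \<omega>) \<partial>P) = 0" for i j
      using integral_past_mult_future(2)[OF P Suc.prems sm[of i], of "h j"]
        L2_space_imp_integrable[OF fm SL2[of i]]
        L2_space_imp_integrable[OF prob_space.finite_measure[OF iid_sample_prob_space[OF P Suc.prems]] h[of j]]
      by (simp add: Ss[symmetric] mean0)
    have hm: "(\<lambda>\<omega>. h i (Z m \<omega>)) \<in> L2_space P" for i
      by (rule hL2) simp
    note int[simp] = integrable_mult_L2_space[OF SL2 SL2] integrable_mult_L2_space[OF SL2 hm]
      integrable_mult_L2_space[OF hm SL2] integrable_mult_L2_space[OF hm hm]
    have "(\<integral>\<omega>. (\<Sum>r<Suc m. h i (Z r \<omega>)) * (\<Sum>r<Suc m. h j (Z r \<omega>)) \<partial>P)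
        = (\<integral>\<omega>. S i \<omega> * S j \<omega> + S i \<omega> * h j (Z m \<omega>) + S j \<omega> * h i (Z m \<omega>) + h i (Z m \<omega>) * h j (Z m \<omega>) \<partial>P)"
      by (intro Bochner_Integration.integral_cong) (auto simp: S_def algebra_simps)
    also have "\<dots> = (\<integral>\<omega>. S i \<omega> * S j \<omega> \<partial>P) + (\<integral>\<omega>. h i (Z m \<omega>) * h j (Z m \<omega>) \<partial>P)"
      by (simp add: cross)
    also have "(\<integral>\<omega>. h i (Z m \<omega>) * h j (Z m \<omega>) \<partial>P) = (\<integral>z. h i z * h j z \<partial>L)"
      using integral_distr[of "Z m" P L "\<lambda>z. h i z * h j z"] Suc.prems
      by (auto simp: iid_sample_def indep_vars_def2)
    also have "(\<integral>\<omega>. S i \<omega> * S j \<omega> \<partial>P) = real m * (\<integral>z. h i z * h j z \<partial>L)"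
      using Suc.IH[OF iid] by (simp add: S_def)
    finally show ?case by (simp add: algebra_simps)
  qed simp
qed

text \<open>A completely degenerate part of order two plus a linear part: the two components of the Hoeffding
  decomposition, kept in one function because they obey a common recursion in \<open>n\<close>.\<close>

definition U_stat :: "(nat \<Rightarrow> 'z \<Rightarrow> real) \<Rightarrow> (nat \<Rightarrow> real) \<Rightarrow> nat \<Rightarrow> nat \<Rightarrow> (nat \<Rightarrow> 'z) \<Rightarrow> real" where
  "U_stat h c k n z =
     (\<Sum>r<n. \<Sum>s\<in>{..<n} - {r}. \<Sum>i<k. h i (z r) * h i (z s)) + (\<Sum>r<n. \<Sum>i<k. c i * h i (z r))"

text \<open>Adding an observation changes the statistic by a linear form in the new vector with coefficients
  that depend on the past only, so for centred \<open>h\<close> the statistic is a martingale. The factor 2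
  comes from the pairs \<open>(r, n)\<close> and \<open>(n, r)\<close>.\<close>

lemma U_stat_Suc:
  "U_stat h c k (Suc n) z =
     U_stat h c k n z + (\<Sum>i<k. (2 * (\<Sum>r<n. h i (z r)) + c i) * h i (z n))"
proof -
  let ?G = "\<lambda>r s. \<Sum>i<k. h i (z r) * h i (z s)"
  have d: "(\<Sum>s\<in>{..<m} - {r}. ?G r s) = (\<Sum>s<m. ?G r s) - ?G r r" if "r < m" for r m :: nat
    using that by (subst sum_diff1) auto
  have G: "(\<Sum>r<n. ?G r n) = (\<Sum>i<k. (\<Sum>r<n. h i (z r)) * h i (z n))"
    by (subst sum.swap) (simp add: sum_distrib_right)
  have G': "(\<Sum>s<n. ?G n s) = (\<Sum>r<n. ?G r n)"
    by (simp add: mult.commute)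
  have "(\<Sum>r<Suc n. \<Sum>s\<in>{..<Suc n} - {r}. ?G r s)
      = (\<Sum>r<n. \<Sum>s\<in>{..<n} - {r}. ?G r s) + 2 * (\<Sum>r<n. ?G r n)"
    by (simp add: d sum.distrib sum_subtractf G' del: sum.lessThan_Suc)
      (simp add: sum.distrib G')
  then show ?thesis
    unfolding U_stat_def G by (simp add: sum.distrib sum_distrib_left algebra_simps)
qed

lemma U_stat_cong: "(\<And>r. r < n \<Longrightarrow> z r = z' r) \<Longrightarrow> U_stat h c k n z = U_stat h c k n z'"
  by (simp add: U_stat_def)

text \<open>Martingale increments are uncorrelated with the past, so the second moments of the increments add
  up. With \<open>S\<^sub>m\<close> the sum of the first \<open>m\<close> vectors and \<open>C\<close> their covariance matrix, the increment
  \<open>\<langle>2 S\<^sub>m + c, h(Z\<^sub>m)\<rangle>\<close> has second moment \<open>4 m tr C\<^sup>2 + c\<^sup>T C c\<close>, and the sum of \<open>4 m\<close> over \<open>m < n\<close> is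
  \<open>2 n (n - 1)\<close>.\<close>

lemma U_stat_second_moment:
  fixes h :: "nat \<Rightarrow> 'z \<Rightarrow> real"
  assumes P: "prob_space P" and iid: "iid_sample P L n Z"
    and h: "\<And>i. h i \<in> L2_space L" and mean0: "\<And>i. (\<integral>z. h i z \<partial>L) = 0"
  shows "(\<lambda>\<omega>. U_stat h c k n (sample_of n Z \<omega>)) \<in> L2_space P"
    and "(\<integral>\<omega>. (U_stat h c k n (sample_of n Z \<omega>))\<^sup>2 \<partial>P) =
      2 * real n * (real n - 1) * (\<Sum>i<k. \<Sum>j<k. (\<integral>z. h i z * h j z \<partial>L)\<^sup>2)
        + real n * (\<integral>z. (\<Sum>i<k. c i * h i z)\<^sup>2 \<partial>L)"
proof -
  interpret prob_space P by fact
  have fm: "finite_measure P" by unfold_locales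
  define C where "C i j = (\<integral>z. h i z * h j z \<partial>L)" for i j
  define Q where "Q = (\<integral>z. (\<Sum>i<k. c i * h i z)\<^sup>2 \<partial>L)"
  have Q: "Q = (\<Sum>i<k. \<Sum>j<k. c i * c j * C i j)"
  proof -
    have "Q = (\<integral>z. (\<Sum>i<k. \<Sum>j<k. c i * c j * (h i z * h j z)) \<partial>L)"
      unfolding Q_def power2_eq_square sum_product by (simp add: ac_simps)
    also have "\<dots> = (\<Sum>i<k. \<integral>z. (\<Sum>j<k. c i * c j * (h i z * h j z)) \<partial>L)"
      by (intro Bochner_Integration.integral_sum Bochner_Integration.integrable_sum integrable_mult_right
          integrable_mult_L2_space h)
    also have "\<dots> = (\<Sum>i<k. \<Sum>j<k. c i * c j * C i j)"
      by (simp add: C_def integrable_mult_L2_space[OF h h])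
    finally show ?thesis .
  qed
  have "(\<lambda>\<omega>. U_stat h c k n (sample_of n Z \<omega>)) \<in> L2_space P \<and>
    (\<integral>\<omega>. (U_stat h c k n (sample_of n Z \<omega>))\<^sup>2 \<partial>P) =
      2 * real n * (real n - 1) * (\<Sum>i<k. \<Sum>j<k. (C i j)\<^sup>2) + real n * Q"
    using iid
  proof (induction n)
    case 0
    show ?case by (simp add: U_stat_def L2_space_def)
  next
    case (Suc m)
    have iid: "iid_sample P L m Z"
      using iid_sample_mono[OF P Suc.prems] by simp
    note [measurable] = L2_spaceD(1)[OF h]
    have Lfm: "finite_measure L"
      by (rule prob_space.finite_measure[OF iid_sample_prob_space[OF P Suc.prems]])
    define w where "w = U_stat h c k m"
    define u where "u i z = 2 * (\<Sum>r<m. h i (z r)) + c i" for i and z :: "nat \<Rightarrow> 'z"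
    define W where "W \<omega> = w (sample_of m Z \<omega>)" for \<omega>
    define V where "V i \<omega> = u i (sample_of m Z \<omega>)" for i \<omega>
    define D where "D \<omega> = (\<Sum>i<k. V i \<omega> * h i (Z m \<omega>))" for \<omega>
    have rec: "U_stat h c k (Suc m) (sample_of (Suc m) Z \<omega>) = W \<omega> + D \<omega>" for \<omega>
      unfolding U_stat_Suc W_def w_def D_def V_def u_def
      by (intro arg_cong2[where f="(+)"] U_stat_cong sum.cong) (simp_all add: sample_of_nth)
    have wm: "w \<in> borel_measurable (PiM {..<m} (\<lambda>_. L))"
      unfolding w_def U_stat_def by measurable
    have um: "u i \<in> borel_measurable (PiM {..<m} (\<lambda>_. L))" for i
      unfolding u_def by measurable
    have WL2: "W \<in> L2_space P" and W2: "(\<integral>\<omega>. (W \<omega>)\<^sup>2 \<partial>P) =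
        2 * real m * (real m - 1) * (\<Sum>i<k. \<Sum>j<k. (C i j)\<^sup>2) + real m * Q"
      using Suc.IH[OF iid] by (auto simp: W_def[abs_def] w_def)
    define S where "S i \<omega> = (\<Sum>r<m. h i (Z r \<omega>))" for i \<omega>
    have VS: "V i \<omega> = 2 * S i \<omega> + c i" for i \<omega>
      by (simp add: V_def u_def S_def sample_of_nth)
    have SL2: "S i \<in> L2_space P" for i
      unfolding S_def by (intro L2_space_sum L2_space_observation[OF P iid _ h]) simp
    have ES: "(\<integral>\<omega>. S i \<omega> \<partial>P) = 0" for i
      using centred_sum_moments(1)[OF P iid h mean0] by (simp add: S_def)
    have VL2: "V i \<in> L2_space P" for i
      unfolding VS by (intro L2_space_add L2_space_cmult SL2 L2_space_const fm)
    have VV: "(\<integral>\<omega>. V i \<omega> * V j \<omega> \<partial>P) = 4 * real m * C i j + c i * c j" for i j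
    proof -
      have "(\<integral>\<omega>. V i \<omega> * V j \<omega> \<partial>P)
          = (\<integral>\<omega>. 4 * (S i \<omega> * S j \<omega>) + 2 * c j * S i \<omega> + 2 * c i * S j \<omega> + c i * c j \<partial>P)"
        by (intro Bochner_Integration.integral_cong) (auto simp: VS algebra_simps)
      also have "\<dots> = 4 * (\<integral>\<omega>. S i \<omega> * S j \<omega> \<partial>P) + c i * c j"
        by (simp add: integrable_mult_L2_space[OF SL2 SL2] L2_space_imp_integrable[OF fm SL2]
            ES prob_space)
      finally show ?thesis
        using centred_sum_moments(2)[OF P iid h mean0] by (simp add: S_def C_def)
    qed
    \<comment> \<open>Square integrability of the past functions makes their product integrable, hence the products
      of up to four factors below, even though the \<open>h\<^sub>i\<close> have only two moments.\<close>
    have fac: "integrable P (\<lambda>\<omega>. (a (sample_of m Z \<omega>) * b (sample_of m Z \<omega>)) * g (Z m \<omega>))"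
      "(\<integral>\<omega>. (a (sample_of m Z \<omega>) * b (sample_of m Z \<omega>)) * g (Z m \<omega>) \<partial>P)
         = (\<integral>\<omega>. a (sample_of m Z \<omega>) * b (sample_of m Z \<omega>) \<partial>P) * (\<integral>z. g z \<partial>L)"
      if a: "a \<in> borel_measurable (PiM {..<m} (\<lambda>_. L))" "(\<lambda>\<omega>. a (sample_of m Z \<omega>)) \<in> L2_space P"
        and b: "b \<in> borel_measurable (PiM {..<m} (\<lambda>_. L))" "(\<lambda>\<omega>. b (sample_of m Z \<omega>)) \<in> L2_space P"
        and g: "integrable L g" for a b g
      using integral_past_mult_future[OF P Suc.prems borel_measurable_times[OF a(1) b(1)]
          integrable_mult_L2_space[OF a(2) b(2)] g] .
    have hZ: "(\<lambda>\<omega>. h i (Z m \<omega>)) \<in> L2_space P" for i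
      using L2_space_observation[OF P Suc.prems _ h] by simp
    have Vh: "integrable P (\<lambda>\<omega>. (V i \<omega> * V j \<omega>) * (h i (Z m \<omega>) * h j (Z m \<omega>)))"
      "(\<integral>\<omega>. (V i \<omega> * V j \<omega>) * (h i (Z m \<omega>) * h j (Z m \<omega>)) \<partial>P) = (4 * real m * C i j + c i * c j) * C i j" for i j
      using fac[OF um _ um _ integrable_mult_L2_space[OF h h], of i j i j] VL2 VV
      unfolding V_def C_def by auto
    have Wh: "integrable P (\<lambda>\<omega>. (W \<omega> * V i \<omega>) * h i (Z m \<omega>))"
      "(\<integral>\<omega>. (W \<omega> * V i \<omega>) * h i (Z m \<omega>) \<partial>P) = 0" for i
      using fac[OF wm _ um _ L2_space_imp_integrable[OF Lfm h], of i i] WL2 VL2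
      unfolding V_def W_def by (auto simp: mean0)
    have Vh_L2: "(\<lambda>\<omega>. V i \<omega> * h i (Z m \<omega>)) \<in> L2_space P" for i
      using Vh(1)[of i i] L2_spaceD(1)[OF VL2, of i] L2_spaceD(1)[OF hZ, of i]
      by (auto simp: L2_space_def power2_eq_square ac_simps)
    have DL2: "D \<in> L2_space P"
      unfolding D_def by (intro L2_space_sum Vh_L2)
    have D2: "(\<integral>\<omega>. (D \<omega>)\<^sup>2 \<partial>P) = 4 * real m * (\<Sum>i<k. \<Sum>j<k. (C i j)\<^sup>2) + Q"
    proof -
      have "(\<integral>\<omega>. (D \<omega>)\<^sup>2 \<partial>P) = (\<integral>\<omega>. (\<Sum>i<k. \<Sum>j<k. (V i \<omega> * V j \<omega>) * (h i (Z m \<omega>) * h j (Z m \<omega>))) \<partial>P)"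
        unfolding D_def power2_eq_square sum_product by (simp add: ac_simps)
      also have "\<dots> = (\<Sum>i<k. \<integral>\<omega>. (\<Sum>j<k. (V i \<omega> * V j \<omega>) * (h i (Z m \<omega>) * h j (Z m \<omega>))) \<partial>P)"
        by (intro Bochner_Integration.integral_sum Bochner_Integration.integrable_sum Vh)
      also have "\<dots> = (\<Sum>i<k. \<Sum>j<k. (4 * real m * C i j + c i * c j) * C i j)"
        by (subst Bochner_Integration.integral_sum) (simp_all only: Vh)
      finally show ?thesis
        by (simp add: Q sum_distrib_left sum.distrib[symmetric] power2_eq_square algebra_simps)
    qed
    have WD: "(\<integral>\<omega>. W \<omega> * D \<omega> \<partial>P) = 0"
    proof -
      have "(\<integral>\<omega>. W \<omega> * D \<omega> \<partial>P) = (\<integral>\<omega>. (\<Sum>i<k. (W \<omega> * V i \<omega>) * h i (Z m \<omega>)) \<partial>P)"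
        unfolding D_def sum_distrib_left by (simp add: ac_simps)
      also have "\<dots> = 0"
        by (subst Bochner_Integration.integral_sum) (simp_all only: Wh sum.neutral_const)
      finally show ?thesis .
    qed
    have "(\<integral>\<omega>. (W \<omega> + D \<omega>)\<^sup>2 \<partial>P) = (\<integral>\<omega>. (W \<omega>)\<^sup>2 + (D \<omega>)\<^sup>2 + 2 * (W \<omega> * D \<omega>) \<partial>P)"
      by (intro Bochner_Integration.integral_cong) (auto simp: power2_sum)
    also have "\<dots> = (\<integral>\<omega>. (W \<omega>)\<^sup>2 \<partial>P) + (\<integral>\<omega>. (D \<omega>)\<^sup>2 \<partial>P)"
      using L2_spaceD(2)[OF WL2] L2_spaceD(2)[OF DL2] integrable_mult_L2_space[OF WL2 DL2]
      by (simp add: WD)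
    also have "\<dots> = 2 * real (Suc m) * (real (Suc m) - 1) * (\<Sum>i<k. \<Sum>j<k. (C i j)\<^sup>2) + real (Suc m) * Q"
      unfolding W2 D2 by (simp add: algebra_simps)
    finally show ?case
      using L2_space_add[OF WL2 DL2] by (simp only: rec)
  qed
  then show "(\<lambda>\<omega>. U_stat h c k n (sample_of n Z \<omega>)) \<in> L2_space P"
    and "(\<integral>\<omega>. (U_stat h c k n (sample_of n Z \<omega>))\<^sup>2 \<partial>P) =
      2 * real n * (real n - 1) * (\<Sum>i<k. \<Sum>j<k. (\<integral>z. h i z * h j z \<partial>L)\<^sup>2)
        + real n * (\<integral>z. (\<Sum>i<k. c i * h i z)\<^sup>2 \<partial>L)"
    by (simp_all add: C_def Q_def)
qed

section \<open>Moments of the regression model\<close>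

lemma subalgebra_vimage_algebra: "X \<in> M \<rightarrow>\<^sub>M A \<Longrightarrow> subalgebra M (vimage_algebra (space M) X A)"
  using sets_image_in_sets[OF refl] by (simp add: subalgebra_def)

lemma measurable_comp_vimage_algebra:
  assumes "X \<in> M \<rightarrow>\<^sub>M A" "h \<in> A \<rightarrow>\<^sub>M K"
  shows "(\<lambda>\<omega>. h (X \<omega>)) \<in> vimage_algebra (space M) X A \<rightarrow>\<^sub>M K"
  using assms(1) by (intro measurable_compose[OF measurable_vimage_algebra1 assms(2)]) (auto simp: measurable_def)

lemma integral_cond_exp_version:
  assumes M: "prob_space M" and X: "X \<in> M \<rightarrow>\<^sub>M A" and g: "cond_exp_version M A X U g"
    and h: "h \<in> borel_measurable A" and int: "integrable M (\<lambda>\<omega>. h (X \<omega>) * U \<omega>)"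
  shows "(\<integral>\<omega>. h (X \<omega>) * U \<omega> \<partial>M) = (\<integral>\<omega>. h (X \<omega>) * g (X \<omega>) \<partial>M)"
proof -
  interpret prob_space M by fact
  interpret finite_measure_subalgebra M "vimage_algebra (space M) X A"
    by standard (rule subalgebra_vimage_algebra[OF X])
  have [measurable]: "g \<in> borel_measurable A" "U \<in> borel_measurable M"
    and ae: "AE \<omega> in M. real_cond_exp M (vimage_algebra (space M) X A) U \<omega> = g (X \<omega>)"
    using g by (auto simp: cond_exp_version_def)
  note [measurable] = X h
  have "(\<integral>\<omega>. h (X \<omega>) * U \<omega> \<partial>M) = (\<integral>\<omega>. h (X \<omega>) * real_cond_exp M (vimage_algebra (space M) X A) U \<omega> \<partial>M)"
    by (rule real_cond_exp_intg(2)[symmetric, OF int measurable_comp_vimage_algebra[OF X h]]) simp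
  also have "\<dots> = (\<integral>\<omega>. h (X \<omega>) * g (X \<omega>) \<partial>M)"
    using ae by (intro integral_cong_AE) auto
  finally show ?thesis .
qed

text \<open>Integrability of the product is not automatic, as neither \<open>U\<close> nor \<open>h(X)\<close> need be bounded; it is this
  that makes \<open>\<epsilon> e\<^sub>i(X)\<close> square integrable. It is obtained from the conditional expectation of
  nonnegative functions, whose defining identity holds without integrability.\<close>

lemma integrable_mult_of_bounded_cond_exp:
  assumes M: "prob_space M" and X: "X \<in> M \<rightarrow>\<^sub>M A" and g: "cond_exp_version M A X U g"
    and U0: "\<And>\<omega>. 0 \<le> U \<omega>" and gB: "\<And>x. x \<in> space A \<Longrightarrow> g x \<le> B"
    and h: "h \<in> borel_measurable A" "\<And>x. 0 \<le> h x" and int: "integrable M (\<lambda>\<omega>. h (X \<omega>))"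
  shows "integrable M (\<lambda>\<omega>. h (X \<omega>) * U \<omega>)"
    and "(\<integral>\<omega>. h (X \<omega>) * U \<omega> \<partial>M) \<le> B * (\<integral>\<omega>. h (X \<omega>) \<partial>M)"
proof -
  interpret prob_space M by fact
  let ?F = "vimage_algebra (space M) X A"
  interpret finite_measure_subalgebra M ?F
    by standard (rule subalgebra_vimage_algebra[OF X])
  have [measurable]: "g \<in> borel_measurable A" "U \<in> borel_measurable M" and Uint: "integrable M U"
    and ae: "AE \<omega> in M. real_cond_exp M ?F U \<omega> = g (X \<omega>)"
    using g by (auto simp: cond_exp_version_def)
  note [measurable] = X h(1)
  let ?C = "nn_cond_exp M ?F (\<lambda>\<omega>. ennreal (U \<omega>))"
  \<comment> \<open>As \<open>U \<ge> 0\<close>, the real conditional expectation is its positive part, so the bound on \<open>g\<close> passes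
    to the extended-valued one, apart from the null set where that is infinite.\<close>
  have neg: "(\<lambda>\<omega>. ennreal (- U \<omega>)) = (\<lambda>_. 0)"
    using U0 by (auto simp: ennreal_neg)
  have neg0: "AE \<omega> in M. nn_cond_exp M ?F (\<lambda>\<omega>. ennreal (- U \<omega>)) \<omega> = 0"
    unfolding neg using nn_cond_exp_F_meas[of "\<lambda>_. 0"] by auto
  have "(\<integral>\<^sup>+\<omega>. ?C \<omega> \<partial>M) = (\<integral>\<^sup>+\<omega>. ennreal (U \<omega>) \<partial>M)"
    using nn_cond_exp_intg[of "\<lambda>_. 1" "\<lambda>\<omega>. ennreal (U \<omega>)"] by simp
  also have "\<dots> \<noteq> \<infinity>"
    using Uint U0 by (simp add: integrable_iff_bounded)
  finally have fin: "AE \<omega> in M. ?C \<omega> \<noteq> \<infinity>"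
    by (intro nn_integral_PInf_AE) auto
  have le: "AE \<omega> in M. ?C \<omega> \<le> ennreal B"
    using neg0 fin ae AE_space
  proof eventually_elim
    case (elim \<omega>)
    then have "enn2real (?C \<omega>) = g (X \<omega>)"
      by (simp add: real_cond_exp_def)
    also have "g (X \<omega>) \<le> B"
      using elim measurable_space[OF X] by (intro gB) auto
    finally have "ennreal (enn2real (?C \<omega>)) \<le> ennreal B"
      by (rule ennreal_leI)
    then show ?case using elim by (simp add: top.not_eq_extremum)
  qed
  have "(\<integral>\<^sup>+\<omega>. ennreal (norm (h (X \<omega>) * U \<omega>)) \<partial>M) = (\<integral>\<^sup>+\<omega>. ennreal (h (X \<omega>)) * ennreal (U \<omega>) \<partial>M)"
    using h U0 by (simp add: ennreal_mult)
  also have "\<dots> = (\<integral>\<^sup>+\<omega>. ennreal (h (X \<omega>)) * ?C \<omega> \<partial>M)"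
    by (rule nn_cond_exp_intg[symmetric])
      (use measurable_comp_vimage_algebra[OF X h(1)] in measurable)
  also have "\<dots> \<le> (\<integral>\<^sup>+\<omega>. ennreal (h (X \<omega>)) * ennreal B \<partial>M)"
    by (intro nn_integral_mono_AE eventually_mono[OF le] mult_left_mono) auto
  also have "\<dots> = (\<integral>\<^sup>+\<omega>. ennreal (h (X \<omega>)) \<partial>M) * ennreal B"
    by (rule nn_integral_multc) simp
  also have "\<dots> < \<infinity>"
    using int h(2) by (simp add: integrable_iff_bounded ennreal_mult_less_top)
  finally show hU: "integrable M (\<lambda>\<omega>. h (X \<omega>) * U \<omega>)"
    by (intro integrableI_bounded) auto
  have "(\<integral>\<omega>. h (X \<omega>) * U \<omega> \<partial>M) = (\<integral>\<omega>. h (X \<omega>) * real_cond_exp M ?F U \<omega> \<partial>M)"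
    by (rule real_cond_exp_intg(2)[symmetric, OF hU measurable_comp_vimage_algebra[OF X h(1)]]) simp
  also have "\<dots> \<le> (\<integral>\<omega>. h (X \<omega>) * B \<partial>M)"
  proof (rule integral_mono_AE)
    show "integrable M (\<lambda>\<omega>. h (X \<omega>) * real_cond_exp M ?F U \<omega>)"
      by (rule real_cond_exp_intg(1)[OF hU measurable_comp_vimage_algebra[OF X h(1)]]) simp
    show "AE \<omega> in M. h (X \<omega>) * real_cond_exp M ?F U \<omega> \<le> h (X \<omega>) * B"
      using ae AE_space
      by eventually_elim (use h(2) gB measurable_space[OF X] in \<open>auto intro!: mult_left_mono\<close>)
  qed (use int in auto)
  finally show "(\<integral>\<omega>. h (X \<omega>) * U \<omega> \<partial>M) \<le> B * (\<integral>\<omega>. h (X \<omega>) \<partial>M)"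
    by (simp add: mult.commute)
qed

text \<open>Conditioning on \<open>X\<close> turns \<open>Y\<^sup>2\<close> into \<open>f\<^sup>2 + \<sigma>\<^sup>2\<close> and \<open>Y\<close> into \<open>f\<close>. The weight \<open>g\<close> may be unbounded, so the
  cross term \<open>f g\<^sup>2 \<epsilon>\<close> is first seen to be integrable as a product of the square-integrable functions
  \<open>f g\<close> and \<open>\<epsilon> g\<close>.\<close>

lemma regression_moments:
  assumes M: "prob_space M" and X: "X \<in> M \<rightarrow>\<^sub>M A" and eps: "eps \<in> borel_measurable M"
    and mean: "cond_exp_version M A X eps (\<lambda>_. 0)"
    and var: "cond_exp_version M A X (\<lambda>\<omega>. (eps \<omega>)\<^sup>2) sigma2"
    and s: "\<And>x. x \<in> space A \<Longrightarrow> sigma2 x \<le> B"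
    and f: "f \<in> borel_measurable A" "\<And>x. x \<in> space A \<Longrightarrow> \<bar>f x\<bar> \<le> D"
    and g: "g \<in> L2_space (distr M A X)"
  shows "(\<lambda>\<omega>. (f (X \<omega>) + eps \<omega>) * g (X \<omega>)) \<in> L2_space M"
    and "(\<integral>\<omega>. ((f (X \<omega>) + eps \<omega>) * g (X \<omega>))\<^sup>2 \<partial>M) \<le> (D\<^sup>2 + B) * (\<integral>x. (g x)\<^sup>2 \<partial>distr M A X)"
    and "(\<integral>\<omega>. (f (X \<omega>) + eps \<omega>) * g (X \<omega>) \<partial>M) = (\<integral>x. f x * g x \<partial>distr M A X)"
proof -
  interpret prob_space M by fact
  have fm: "finite_measure M" by unfold_locales
  note [measurable] = X eps f(1)
  have gm[measurable]: "g \<in> borel_measurable A"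
    using L2_spaceD(1)[OF g] by simp
  have g2: "integrable M (\<lambda>\<omega>. (g (X \<omega>))\<^sup>2)"
    using L2_spaceD(2)[OF g] by (simp add: integrable_distr_eq)
  have gL2: "(\<lambda>\<omega>. g (X \<omega>)) \<in> L2_space M"
    using g2 by (simp add: L2_space_def)
  have XA: "X \<omega> \<in> space A" if "\<omega> \<in> space M" for \<omega>
    using measurable_space[OF X that] .
  have fD: "(f (X \<omega>))\<^sup>2 \<le> D\<^sup>2" if "\<omega> \<in> space M" for \<omega>
    using power_mono[OF f(2)[OF XA[OF that]], of 2] by simp
  have fgL2: "(\<lambda>\<omega>. f (X \<omega>) * g (X \<omega>)) \<in> L2_space M"
  proof -
    have "integrable M (\<lambda>\<omega>. (f (X \<omega>) * g (X \<omega>))\<^sup>2)"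
    proof (rule Bochner_Integration.integrable_bound)
      show "integrable M (\<lambda>\<omega>. D\<^sup>2 * (g (X \<omega>))\<^sup>2)" using g2 by simp
      show "AE \<omega> in M. norm ((f (X \<omega>) * g (X \<omega>))\<^sup>2) \<le> norm (D\<^sup>2 * (g (X \<omega>))\<^sup>2)"
        using fD by (auto simp: power_mult_distrib intro!: mult_right_mono)
    qed measurable
    then show ?thesis by (simp add: L2_space_def)
  qed
  note e2 = integrable_mult_of_bounded_cond_exp[OF M X var _ s, of "\<lambda>x. (g x)\<^sup>2"]
  have egL2: "(\<lambda>\<omega>. eps \<omega> * g (X \<omega>)) \<in> L2_space M"
    using e2(1) g2 by (simp add: L2_space_def power_mult_distrib mult.commute)
  show YgL2: "(\<lambda>\<omega>. (f (X \<omega>) + eps \<omega>) * g (X \<omega>)) \<in> L2_space M"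
    using L2_space_add[OF fgL2 egL2] by (simp add: algebra_simps)
  have cross_int: "integrable M (\<lambda>\<omega>. (f (X \<omega>) * (g (X \<omega>))\<^sup>2) * eps \<omega>)"
    using integrable_mult_L2_space[OF fgL2 egL2] by (simp add: power2_eq_square ac_simps)
  have cross: "(\<integral>\<omega>. (f (X \<omega>) * (g (X \<omega>))\<^sup>2) * eps \<omega> \<partial>M) = 0"
    using integral_cond_exp_version[OF M X mean, of "\<lambda>x. f x * (g x)\<^sup>2"] cross_int by simp
  have "(\<integral>\<omega>. ((f (X \<omega>) + eps \<omega>) * g (X \<omega>))\<^sup>2 \<partial>M)
      = (\<integral>\<omega>. (f (X \<omega>) * g (X \<omega>))\<^sup>2 + 2 * ((f (X \<omega>) * (g (X \<omega>))\<^sup>2) * eps \<omega>) + (g (X \<omega>))\<^sup>2 * (eps \<omega>)\<^sup>2 \<partial>M)"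
    by (intro Bochner_Integration.integral_cong) (auto simp: power2_eq_square algebra_simps)
  also have "\<dots> = (\<integral>\<omega>. (f (X \<omega>) * g (X \<omega>))\<^sup>2 \<partial>M) + (\<integral>\<omega>. (g (X \<omega>))\<^sup>2 * (eps \<omega>)\<^sup>2 \<partial>M)"
    using L2_spaceD(2)[OF fgL2] cross_int cross e2(1) g2 by simp
  also have "\<dots> \<le> (\<integral>\<omega>. D\<^sup>2 * (g (X \<omega>))\<^sup>2 \<partial>M) + B * (\<integral>\<omega>. (g (X \<omega>))\<^sup>2 \<partial>M)"
  proof (rule add_mono)
    show "(\<integral>\<omega>. (f (X \<omega>) * g (X \<omega>))\<^sup>2 \<partial>M) \<le> (\<integral>\<omega>. D\<^sup>2 * (g (X \<omega>))\<^sup>2 \<partial>M)"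
      using L2_spaceD(2)[OF fgL2] g2 fD
      by (intro integral_mono) (auto simp: power_mult_distrib intro!: mult_right_mono)
    show "(\<integral>\<omega>. (g (X \<omega>))\<^sup>2 * (eps \<omega>)\<^sup>2 \<partial>M) \<le> B * (\<integral>\<omega>. (g (X \<omega>))\<^sup>2 \<partial>M)"
      using e2(2) g2 by simp
  qed
  also have "\<dots> = (D\<^sup>2 + B) * (\<integral>x. (g x)\<^sup>2 \<partial>distr M A X)"
    by (simp add: integral_distr algebra_simps)
  finally show "(\<integral>\<omega>. ((f (X \<omega>) + eps \<omega>) * g (X \<omega>))\<^sup>2 \<partial>M) \<le> (D\<^sup>2 + B) * (\<integral>x. (g x)\<^sup>2 \<partial>distr M A X)" .
  have eg: "integrable M (\<lambda>\<omega>. g (X \<omega>) * eps \<omega>)"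
    using L2_space_imp_integrable[OF fm egL2] by (simp add: mult.commute)
  have "(\<integral>\<omega>. (f (X \<omega>) + eps \<omega>) * g (X \<omega>) \<partial>M) = (\<integral>\<omega>. f (X \<omega>) * g (X \<omega>) + g (X \<omega>) * eps \<omega> \<partial>M)"
    by (intro Bochner_Integration.integral_cong) (auto simp: algebra_simps)
  also have "\<dots> = (\<integral>\<omega>. f (X \<omega>) * g (X \<omega>) \<partial>M)"
    using L2_space_imp_integrable[OF fm fgL2] eg integral_cond_exp_version[OF M X mean gm eg] by simp
  also have "\<dots> = (\<integral>x. f x * g x \<partial>distr M A X)"
    by (simp add: integral_distr)
  finally show "(\<integral>\<omega>. (f (X \<omega>) + eps \<omega>) * g (X \<omega>) \<partial>M) = (\<integral>x. f x * g x \<partial>distr M A X)" .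
qed

lemma orthonormal_integral_sum_sq:
  assumes e: "L2_orthonormal_basis Q e"
  shows "(\<integral>x. (\<Sum>i<k. v i * e i x)\<^sup>2 \<partial>Q) = (\<Sum>i<k. (v i)\<^sup>2)"
proof -
  have eL2: "e i \<in> L2_space Q" and on: "(\<integral>x. e i x * e j x \<partial>Q) = (if i = j then 1 else 0)" for i j
    using e by (auto simp: L2_orthonormal_basis_def)
  have "(\<integral>x. (\<Sum>i<k. v i * e i x)\<^sup>2 \<partial>Q) = (\<integral>x. (\<Sum>i<k. \<Sum>j<k. v i * v j * (e i x * e j x)) \<partial>Q)"
    unfolding power2_eq_square sum_product by (simp add: ac_simps)
  also have "\<dots> = (\<Sum>i<k. \<integral>x. (\<Sum>j<k. v i * v j * (e i x * e j x)) \<partial>Q)"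
    by (intro Bochner_Integration.integral_sum Bochner_Integration.integrable_sum integrable_mult_right
        integrable_mult_L2_space eL2)
  also have "\<dots> = (\<Sum>i<k. \<Sum>j<k. v i * v j * (if i = j then 1 else 0))"
    by (simp add: integrable_mult_L2_space[OF eL2 eL2] on)
  also have "\<dots> = (\<Sum>i<k. (v i)\<^sup>2)"
    by (simp add: power2_eq_square if_distrib cong: if_cong)
  finally show ?thesis .
qed

section \<open>The estimator of the squared distance\<close>

text \<open>The Hoeffding decomposition of the error. Each index \<open>r\<close> occurs in \<open>n - 1\<close> pairs as first and in
  \<open>n - 1\<close> pairs as second entry, whence the coefficient of the linear part.\<close>

lemma R_stat_minus_sq_dist:
  assumes "2 \<le> n"
  shows "R_stat e k n t z - sq_dist k \<theta> t =
    1 / (real n * (real n - 1)) *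
    U_stat (\<lambda>i w. snd w * e i (fst w) - \<theta> i) (\<lambda>i. 2 * (real n - 1) * (\<theta> i - t i)) k n z"
proof -
  define h where "h i w = snd w * e i (fst w) - \<theta> i" for i and w :: "'a \<times> real"
  define d where "d i = \<theta> i - t i" for i
  define a where "a r = (\<Sum>i<k. d i * h i (z r))" for r
  have minus: "(\<Sum>s\<in>{..<n} - {r}. b s) = (\<Sum>s<n. b s) - b r" if "r < n" for r and b :: "nat \<Rightarrow> real"
    using that by (subst sum_diff1) auto
  have hd: "snd (z r) * e i (fst (z r)) - t i = h i (z r) + d i" for r i
    by (simp add: h_def d_def)
  have "(\<Sum>r<n. \<Sum>s\<in>{..<n} - {r}. \<Sum>i<k. (h i (z r) + d i) * (h i (z s) + d i))
      = (\<Sum>r<n. \<Sum>s\<in>{..<n} - {r}. (\<Sum>i<k. h i (z r) * h i (z s)) + a r + a s + sq_dist k \<theta> t)"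
    by (simp add: a_def d_def sq_dist_def sum.distrib[symmetric] power2_eq_square algebra_simps)
  also have "\<dots> = (\<Sum>r<n. \<Sum>s\<in>{..<n} - {r}. \<Sum>i<k. h i (z r) * h i (z s))
      + 2 * (real n - 1) * (\<Sum>r<n. a r) + real n * (real n - 1) * sq_dist k \<theta> t"
    using assms
    by (simp add: sum.distrib minus sum_subtractf sum_distrib_left[symmetric] sum_distrib_right[symmetric] of_nat_diff algebra_simps)
  also have "\<dots> = U_stat h (\<lambda>i. 2 * (real n - 1) * d i) k n z + real n * (real n - 1) * sq_dist k \<theta> t"
    by (simp add: U_stat_def a_def sum_distrib_left mult.assoc)
  finally show ?thesis
    using assms unfolding R_stat_def hd h_def[symmetric] d_def[symmetric] by (simp add: field_simps)
qed

lemma nn_integral_normalized_le_1: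
  assumes E: "E \<in> L2_space P" and le: "(\<integral>\<omega>. (E \<omega>)\<^sup>2 \<partial>P) \<le> \<tau>\<^sup>2" and "0 \<le> \<tau>"
  shows "(\<integral>\<^sup>+\<omega>. (ennreal \<bar>E \<omega>\<bar> / ennreal \<tau>)\<^sup>2 \<partial>P) \<le> 1"
proof (cases "\<tau> = 0")
  case True
  with le have "(\<integral>\<omega>. (E \<omega>)\<^sup>2 \<partial>P) = 0"
    by (simp add: order.antisym)
  then have "AE \<omega> in P. (E \<omega>)\<^sup>2 = 0"
    using L2_spaceD(2)[OF E] by (subst (asm) integral_nonneg_eq_0_iff_AE) auto
  then have "(\<integral>\<^sup>+\<omega>. (ennreal \<bar>E \<omega>\<bar> / ennreal \<tau>)\<^sup>2 \<partial>P) = (\<integral>\<^sup>+\<omega>. 0 \<partial>P)"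
    by (intro nn_integral_cong_AE) auto
  then show ?thesis by simp
next
  case False
  with \<open>0 \<le> \<tau>\<close> have \<tau>: "0 < \<tau>" by simp
  have "(\<integral>\<^sup>+\<omega>. (ennreal \<bar>E \<omega>\<bar> / ennreal \<tau>)\<^sup>2 \<partial>P) = (\<integral>\<^sup>+\<omega>. ennreal ((E \<omega>)\<^sup>2 / \<tau>\<^sup>2) \<partial>P)"
    using \<tau> by (simp add: divide_ennreal ennreal_power power_divide)
  also have "\<dots> = ennreal (\<integral>\<omega>. (E \<omega>)\<^sup>2 / \<tau>\<^sup>2 \<partial>P)"
    using L2_spaceD(2)[OF E] by (intro nn_integral_eq_integral) auto
  also have "\<dots> \<le> ennreal 1"
    using le \<tau> by (intro ennreal_leI) (simp add: divide_le_eq)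
  finally show ?thesis by simp
qed

lemma abs_le_sup_norm:
  assumes "\<forall>x\<in>space A. \<bar>f x\<bar> \<le> B" "x \<in> space A"
  shows "\<bar>f x\<bar> \<le> sup_norm A f"
  unfolding sup_norm_def using assms by (intro cSUP_upper) (auto intro!: bdd_aboveI[where M=B])

text \<open>The version \<open>\<sigma>\<^sup>2\<close> of the conditional variance may be negative on a null set. The inequality holds
  nevertheless, since the real square root is extended to negative numbers as an odd function.\<close>

lemma sup_norm_le_sup_norm_sqrt_sq:
  assumes "\<forall>x\<in>space A. \<bar>s x\<bar> \<le> B" "space A \<noteq> {}"
  shows "sup_norm A s \<le> (sup_norm A (\<lambda>x. sqrt (s x)))\<^sup>2"
  unfolding sup_norm_def[of A s]
proof (rule cSUP_least[OF assms(2)])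
  fix x assume x: "x \<in> space A"
  have "\<bar>sqrt (s x)\<bar> \<le> sup_norm A (\<lambda>x. sqrt (s x))"
    using assms(1) by (intro abs_le_sup_norm[OF _ x, of _ "sqrt B"]) (simp flip: real_sqrt_abs2)
  then have "(\<bar>sqrt (s x)\<bar>)\<^sup>2 \<le> (sup_norm A (\<lambda>x. sqrt (s x)))\<^sup>2"
    by (intro power_mono) auto
  then show "\<bar>s x\<bar> \<le> (sup_norm A (\<lambda>x. sqrt (s x)))\<^sup>2"
    by (simp flip: real_sqrt_abs2 add: real_sqrt_abs)
qed

text \<open>The exact second moment, with both terms estimated by the bound \<open>D\<^sup>2 + B\<close> for the covariance form of
  \<open>Y e\<^sub>i(X) - \<theta>\<^sub>i\<close>.\<close>

lemma R_stat_mean_square_error: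
  fixes X :: "'w \<Rightarrow> 'x"
  assumes M: "prob_space M" and X: "X \<in> M \<rightarrow>\<^sub>M A" and eps: "eps \<in> borel_measurable M"
    and mean: "cond_exp_version M A X eps (\<lambda>_. 0)"
    and var: "cond_exp_version M A X (\<lambda>\<omega>. (eps \<omega>)\<^sup>2) sigma2"
    and s: "\<And>x. x \<in> space A \<Longrightarrow> sigma2 x \<le> B" and "0 \<le> B"
    and e: "L2_orthonormal_basis (distr M A X) e"
    and f: "f \<in> borel_measurable A" "\<And>x. x \<in> space A \<Longrightarrow> \<bar>f x\<bar> \<le> D"
    and n: "2 \<le> n" and P: "prob_space P"
    and iid: "iid_sample P (distr M (A \<Otimes>\<^sub>M borel) (\<lambda>\<omega>. (X \<omega>, f (X \<omega>) + eps \<omega>))) n Z"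
  defines "\<theta> \<equiv> fourier_coeffs (distr M A X) e f"
  shows "(\<lambda>\<omega>. R_stat e k n t (sample_of n Z \<omega>) - sq_dist k \<theta> t) \<in> L2_space P"
    and "(\<integral>\<omega>. (R_stat e k n t (sample_of n Z \<omega>) - sq_dist k \<theta> t)\<^sup>2 \<partial>P)
      \<le> 2 * real k * (D\<^sup>2 + B)\<^sup>2 / (real n * (real n - 1)) + 4 * (D\<^sup>2 + B) / real n * sq_dist k \<theta> t"
proof -
  interpret prob_space M by fact
  define L where "L = distr M (A \<Otimes>\<^sub>M borel) (\<lambda>\<omega>. (X \<omega>, f (X \<omega>) + eps \<omega>))"
  note [measurable] = X eps f(1)
  interpret L: prob_space L
    unfolding L_def by (rule prob_space_distr) measurable
  note iid = iid[folded L_def]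
  define h where "h i z = snd z * e i (fst z) - \<theta> i" for i and z :: "'x \<times> real"
  define c where "c i = 2 * (real n - 1) * (\<theta> i - t i)" for i
  define N where "N = real n * (real n - 1)"
  have eL2: "e i \<in> L2_space (distr M A X)" for i
    using e by (simp add: L2_orthonormal_basis_def)
  have lin: "(\<lambda>z. snd z * g (fst z)) \<in> L2_space L"
    "(\<integral>z. (snd z * g (fst z))\<^sup>2 \<partial>L) \<le> (D\<^sup>2 + B) * (\<integral>x. (g x)\<^sup>2 \<partial>distr M A X)"
    "(\<integral>z. snd z * g (fst z) \<partial>L) = (\<integral>x. f x * g x \<partial>distr M A X)"
    if g: "g \<in> L2_space (distr M A X)" for g
  proof -
    have [measurable]: "g \<in> borel_measurable A" using L2_spaceD(1)[OF g] by simp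
    note mom = regression_moments[OF M X eps mean var s f g]
    show "(\<lambda>z. snd z * g (fst z)) \<in> L2_space L"
      using L2_spaceD(2)[OF mom(1)] by (simp add: L2_space_def L_def integrable_distr_eq)
    show "(\<integral>z. (snd z * g (fst z))\<^sup>2 \<partial>L) \<le> (D\<^sup>2 + B) * (\<integral>x. (g x)\<^sup>2 \<partial>distr M A X)"
      using mom(2) by (simp add: L_def integral_distr)
    show "(\<integral>z. snd z * g (fst z) \<partial>L) = (\<integral>x. f x * g x \<partial>distr M A X)"
      using mom(3) by (simp add: L_def integral_distr)
  qed
  have hL2: "h i \<in> L2_space L" for i
    unfolding h_def using L2_space_add[OF lin(1)[OF eL2] L2_space_const[OF L.finite_measure_axioms], of i "- \<theta> i"]
    by simp
  have hint: "integrable L (h i)" for i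
    by (rule L2_space_imp_integrable[OF L.finite_measure_axioms hL2])
  have mean0: "(\<integral>z. h i z \<partial>L) = 0" for i
    using lin(3)[OF eL2] L2_space_imp_integrable[OF L.finite_measure_axioms lin(1)[OF eL2]]
    by (simp add: h_def \<theta>_def fourier_coeffs_def L.prob_space)
  have quad: "(\<integral>z. (\<Sum>i<k. v i * h i z)\<^sup>2 \<partial>L) \<le> (D\<^sup>2 + B) * (\<Sum>i<k. (v i)\<^sup>2)" for v
  proof -
    define g where "g x = (\<Sum>i<k. v i * e i x)" for x
    define G where "G z = (\<Sum>i<k. v i * h i z)" for z
    define m where "m = (\<Sum>i<k. v i * \<theta> i)"
    have g: "g \<in> L2_space (distr M A X)"
      unfolding g_def by (intro L2_space_sum L2_space_cmult eL2)
    have GL2: "G \<in> L2_space L"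
      unfolding G_def by (intro L2_space_sum L2_space_cmult hL2)
    have yg: "snd z * g (fst z) = G z + m" for z
      by (simp add: g_def G_def m_def h_def sum_distrib_left sum.distrib[symmetric] algebra_simps)
    have G0: "(\<integral>z. G z \<partial>L) = 0"
      unfolding G_def using hint by (simp add: mean0)
    \<comment> \<open>The variance of \<open>Y g(X)\<close> is at most its second moment.\<close>
    have "(\<integral>z. (G z)\<^sup>2 \<partial>L) \<le> (\<integral>z. (G z)\<^sup>2 \<partial>L) + m\<^sup>2" by simp
    also have "\<dots> = (\<integral>z. (G z)\<^sup>2 + 2 * m * G z + m\<^sup>2 \<partial>L)"
      using L2_spaceD(2)[OF GL2] L2_space_imp_integrable[OF L.finite_measure_axioms GL2]
      by (simp add: G0 L.prob_space)
    also have "\<dots> = (\<integral>z. (snd z * g (fst z))\<^sup>2 \<partial>L)"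
      by (simp add: yg power2_sum ac_simps)
    also have "\<dots> \<le> (D\<^sup>2 + B) * (\<Sum>i<k. (v i)\<^sup>2)"
      using lin(2)[OF g] by (simp add: g_def orthonormal_integral_sum_sq[OF e])
    finally show ?thesis by (simp add: G_def)
  qed
  have R: "R_stat e k n t z - sq_dist k \<theta> t = 1 / N * U_stat h c k n z" for z
    using R_stat_minus_sq_dist[OF n] by (simp add: h_def[abs_def] c_def[abs_def] N_def)
  note U = U_stat_second_moment[OF P iid hL2 mean0, where c=c and k=k]
  show "(\<lambda>\<omega>. R_stat e k n t (sample_of n Z \<omega>) - sq_dist k \<theta> t) \<in> L2_space P"
    unfolding R by (rule L2_space_cmult[OF U(1)])
  have n1: "real n > 0" "real n - 1 > 0" using n by auto
  have "(\<integral>\<omega>. (R_stat e k n t (sample_of n Z \<omega>) - sq_dist k \<theta> t)\<^sup>2 \<partial>P)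
      = (1 / N)\<^sup>2 * (2 * N * (\<Sum>i<k. \<Sum>j<k. (\<integral>z. h i z * h j z \<partial>L)\<^sup>2) + real n * (\<integral>z. (\<Sum>i<k. c i * h i z)\<^sup>2 \<partial>L))"
    unfolding R power_mult_distrib by (simp add: U(2) N_def)
  also have "\<dots> \<le> (1 / N)\<^sup>2 * (2 * N * (real k * (D\<^sup>2 + B)\<^sup>2) + real n * ((D\<^sup>2 + B) * (\<Sum>i<k. (c i)\<^sup>2)))"
    using n1 \<open>0 \<le> B\<close>
    by (intro mult_left_mono add_mono sum_sq_le_of_quadratic_form_le hL2 quad) (auto simp: N_def)
  also have "(\<Sum>i<k. (c i)\<^sup>2) = 4 * (real n - 1)\<^sup>2 * sq_dist k \<theta> t"
    by (simp only: c_def sq_dist_def sum_distrib_left power_mult_distrib) simp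
  also have "(1 / N)\<^sup>2 * (2 * N * (real k * (D\<^sup>2 + B)\<^sup>2) + real n * ((D\<^sup>2 + B) * (4 * (real n - 1)\<^sup>2 * sq_dist k \<theta> t)))
      = 2 * real k * (D\<^sup>2 + B)\<^sup>2 / (real n * (real n - 1)) + 4 * (D\<^sup>2 + B) / real n * sq_dist k \<theta> t"
    using n1 unfolding N_def by (simp add: divide_simps power2_eq_square) (simp add: algebra_simps)
  finally show "(\<integral>\<omega>. (R_stat e k n t (sample_of n Z \<omega>) - sq_dist k \<theta> t)\<^sup>2 \<partial>P)
      \<le> 2 * real k * (D\<^sup>2 + B)\<^sup>2 / (real n * (real n - 1)) + 4 * (D\<^sup>2 + B) / real n * sq_dist k \<theta> t" .
qed

theorem theorem5p1:
  fixes M :: "'w measure" and A :: "'x measure" and X :: "'w \<Rightarrow> 'x" and eps :: "'w \<Rightarrow> real"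
    and PX :: "'x measure" and sigma2 :: "'x \<Rightarrow> real"
    and e :: "nat \<Rightarrow> 'x \<Rightarrow> real" and F :: "('x \<Rightarrow> real) set" and Theta :: "(nat \<Rightarrow> real) set"
    and Om :: "'v measure" and P :: "(nat \<Rightarrow> real) \<Rightarrow> 'v measure"
    and Z :: "nat \<Rightarrow> 'v \<Rightarrow> 'x \<times> real" and theta_hat :: "'v \<Rightarrow> nat \<Rightarrow> real"
    and k n :: nat
  assumes "prob_space M" and "X \<in> M \<rightarrow>\<^sub>M A" and "eps \<in> borel_measurable M"
    and "PX = distr M A X"
    and "cond_exp_version M A X eps (\<lambda>_. 0)"
    and "cond_exp_version M A X (\<lambda>\<omega>. (eps \<omega>)\<^sup>2) sigma2"
    and "\<exists>B. \<forall>x \<in> space A. \<bar>sigma2 x\<bar> \<le> B"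
    and "L2_orthonormal_basis PX e"
    and "F \<subseteq> L2_space PX"
    and "\<exists>B. \<forall>f \<in> F. \<forall>x \<in> space A. \<bar>f x\<bar> \<le> B"
    and "Theta = fourier_coeffs PX e ` F"
    and "n \<ge> 2"
    and "\<And>\<theta>. \<theta> \<in> Theta \<Longrightarrow> prob_space (P \<theta>) \<and> sets (P \<theta>) = sets Om"
    and "\<And>\<theta> f. \<theta> \<in> Theta \<Longrightarrow> f \<in> F \<Longrightarrow> fourier_coeffs PX e f = \<theta> \<Longrightarrow>
           iid_sample (P \<theta>) (distr M (A \<Otimes>\<^sub>M borel) (\<lambda>\<omega>. (X \<omega>, f (X \<omega>) + eps \<omega>))) n Z"
    and "theta_hat \<in> Om \<rightarrow>\<^sub>M ell2_measurable_space"
    and "\<And>\<theta>. \<theta> \<in> Theta \<Longrightarrow>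
           indep_rvs (P \<theta>) ell2_measurable_space theta_hat
             (Pi\<^sub>M {..<n} (\<lambda>_. A \<Otimes>\<^sub>M borel)) (sample_of n Z)"
  shows "\<forall>\<omega> \<in> space Om.
           (SUP \<theta> \<in> Theta. SUP f \<in> {f \<in> F. fourier_coeffs PX e f = \<theta>}.
              cond_exp_given (P \<theta>) theta_hat (sample_of n Z)
                (normalized_sq_error A e f sigma2 k n \<theta>) \<omega>) \<le> 1"
proof (intro ballI SUP_least)
  fix \<omega> \<theta> f
  assume "\<omega> \<in> space Om" and \<theta>: "\<theta> \<in> Theta" and "f \<in> {f \<in> F. fourier_coeffs PX e f = \<theta>}"
  then have f: "f \<in> F" and f\<theta>: "fourier_coeffs PX e f = \<theta>" by auto
  let ?D = "sup_norm A f" and ?B = "sup_norm A sigma2"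
  define t where "t = theta_hat \<omega>"
  interpret prob_space M by fact
  have A: "space A \<noteq> {}"
    using measurable_space[OF assms(2)] not_empty by auto
  obtain Bs Bf where Bs: "\<forall>x\<in>space A. \<bar>sigma2 x\<bar> \<le> Bs" and Bf: "\<forall>x\<in>space A. \<bar>f x\<bar> \<le> Bf"
    using assms(7,10) f by blast
  have s: "\<bar>sigma2 x\<bar> \<le> ?B" if "x \<in> space A" for x
    by (rule abs_le_sup_norm[OF Bs that])
  obtain x where "x \<in> space A" using A by blast
  then have B0: "0 \<le> ?B" using s[of x] by simp
  have "f \<in> L2_space PX" using f assms(9) by auto
  then have fm: "f \<in> borel_measurable A" by (simp add: L2_space_def assms(4))
  have P: "prob_space (P \<theta>)" using assms(13) \<theta> by blast
  note mse = R_stat_mean_square_error[OF assms(1-3,5,6) _ B0 _ fm _ assms(12) P assms(14)[OF \<theta> f f\<theta>],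
      of e ?D k t]
  note mse = mse[OF order.trans[OF abs_ge_self s] assms(8)[unfolded assms(4)] abs_le_sup_norm[OF Bf],
      folded assms(4), unfolded f\<theta>]
  have sd: "0 \<le> sq_dist k \<theta> t"
    by (simp add: sq_dist_def sum_nonneg)
  have n: "0 < real n" "0 < real n - 1" using assms(12) by auto
  have tau: "2 * real k * (?D\<^sup>2 + ?B)\<^sup>2 / (real n * (real n - 1)) + 4 * (?D\<^sup>2 + ?B) / real n * sq_dist k \<theta> t
      \<le> (tau_hat A f sigma2 k n \<theta> t)\<^sup>2"
  proof -
    have "4 * (?D\<^sup>2 + ?B) / real n * sq_dist k \<theta> t
        \<le> (4 * ?D\<^sup>2 + 4 * (sup_norm A (\<lambda>x. sqrt (sigma2 x)))\<^sup>2) / real n * sq_dist k \<theta> t"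
      using sup_norm_le_sup_norm_sqrt_sq[OF Bs A] n sd
      by (intro mult_right_mono divide_right_mono) auto
    moreover have "0 \<le> 2 * real k * (?D\<^sup>2 + ?B)\<^sup>2 / (real n * (real n - 1))"
      using n by simp
    moreover have "0 \<le> (4 * ?D\<^sup>2 + 4 * (sup_norm A (\<lambda>x. sqrt (sigma2 x)))\<^sup>2) / real n * sq_dist k \<theta> t"
      using n sd by simp
    ultimately show ?thesis by (simp add: tau_hat_def)
  qed
  have "0 \<le> tau_hat A f sigma2 k n \<theta> t"
    using n sd by (simp add: tau_hat_def)
  from nn_integral_normalized_le_1[OF mse(1) order.trans[OF mse(2) tau] this]
  show "cond_exp_given (P \<theta>) theta_hat (sample_of n Z) (normalized_sq_error A e f sigma2 k n \<theta>) \<omega> \<le> 1"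
    by (simp add: cond_exp_given_def normalized_sq_error_def t_def)
qed

end
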